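(* Let $q$ be a nonzero complex number that is not a root of $1$, and let $y,d_1,d_2,d_3$ be complex numbers. Put $$k_1=y+d_1d_2+d_1d_3+d_2d_3,\qquad k_2=y(d_1+d_2+d_3)+d_1d_2d_3,$$ and define the rational functions $$Z(x)=\frac{(x-1)(x-y)}{(x^2-qy)(x^2-y)^2(qx^2-y)}\prod_{j=1}^3\bigl((x-d_j)(d_jx-y)\bigr),\qquad V(x)=\frac{(qx-1)(k_1qx-k_2)}{(q-1)(q^2x^2-y)}.$$ Suppose that $V(1)\neq 0$ and $Z(q^k)\neq 0$ for all $k\geq 1$. Define the sequences $$\alpha_k=\frac{\alpha_1Z(q^k)}{Z(q)}\quad(k\geq 1),\qquad \sigma_k=\frac{\sigma_0V(q^k)}{V(1)}\quad(k\geq 0),$$ where $\alpha_1$ is a nonzero number and $\sigma_0$ is defined by $$\sigma_0^2=\frac{\alpha_1V(1)^2}{Z(q)}.$$ Let $\beta_0=\sigma_0$ and $\beta_k=\sigma_k-\sigma_{k-1}$ for $k\geq 1$, let $L$ be the tridiagonal matrix (rows and columns indexed by the nonnegative integers) with $L_{k,k}=\beta_k$, $L_{k,k+1}=1$, $L_{k+1,k}=\alpha_{k+1}$ for $k\geq 0$, and let $A$ be the unique monic matrix in $\mathcal G$ that satisfies $LA=AX$. Then $A$ is an element of the extended $q$-Hahn class $\mathcal J_{q,+}$ that satisfies $$L^2D_q-(q+1)LD_qM+qD_qM^2=tD_q$$ with $$t=-\frac{\alpha_1(q-1)^2d_1d_2d_3}{q^2Z(q)}$$ and with $M$ the tridiagonal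 matrix given by $M_{k,k}=\tilde\beta_k$, $M_{k,k+1}=1$, $M_{k+1,k}=\tilde\alpha_{k+1}$ for $k\geq 0$, where $\tilde\beta_0=\tilde\sigma_0$, $\tilde\beta_k=\tilde\sigma_k-\tilde\sigma_{k-1}$ for $k\geq 1$, and $$\tilde\sigma_k=\frac{[k+1]}{[k+2]}\sigma_{k+1}\quad(k\geq 0),\qquad \tilde\alpha_k=\frac{[k]\,g(k+1)}{q\,[k+1]\,g(k)}\alpha_{k+1}\quad(k\geq 1),$$ with $g(k)=[k-2]c_0+c_1$ for $k\geq 0$, $c_0=[3](q\sigma_0-\sigma_1)+\sigma_2$, $c_1=[3](\sigma_0+\sigma_1-\sigma_2)$.
   Context: All matrices are infinite complex matrices whose rows and columns are indexed by the nonnegative integers. $[k]=\frac{q^k-1}{q-1}$ for $k\in\mathbb Z$. Values of rational functions are taken after cancelling common factors of numerator and denominator. $\mathcal G$ is the group of lower triangular matrices all of whose diagonal entries are nonzero; an element of $\mathcal G$ is monic if all its diagonal entries equal $1$. $\mathcal T$ is the set of tridiagonal matrices all of whose entries on the first subdiagonal and on the first superdiagonal are nonzero (the main diagonal is arbitrary). $X$ is the matrix with $X_{k,k+1}=1$ for $k\geq 0$ and all other entries $0$. $D_q$ is the matrix with $(D_q)_{k+1,k}=[k+1]$ for $k\geq 0$ and all other entries $0$. A monic polynomial sequence $\{p_k\}_{k\geq 0}$ in $\mathbb C[x]$ (with $p_k$ monic of degree $k$) is orthogonal if there are a linear functional $\mu$ on $\mathbb C[x]$ and nonzero complex constants $\gamma_k$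 with $\mu(p_kp_n)=\gamma_k\delta_{k,n}$ for all $k,n\geq 0$. Its associated matrix (with respect to the monomials) is $A=[a_{k,j}]$, where $p_k(x)=\sum_{j=0}^k a_{k,j}x^j$. A matrix arising in this way from a monic orthogonal polynomial sequence is called a MOP (matrix of orthogonal polynomials). For a MOP $A$ there is a unique matrix $L\in\mathcal T$ with $LA=AX$ (the matrix of recurrence coefficients of $A$); it encodes the recurrence $\alpha_kp_{k-1}+\beta_kp_k+p_{k+1}=xp_k$. The extended $q$-Hahn class $\mathcal J_{q,+}$ is the set of all MOPs $A$ whose matrix $L\in\mathcal T$ of recurrence coefficients satisfies $L^2D_q-(q+1)LD_qM+qD_qM^2=tD_q$ for some $M\in\mathcal T$ and some complex number $t$.
   Formalization: For y=q, Z(q) is taken with (x-y)/(x^2-qy) at x=q equal to 1/q (cancelling q-y), not 1/(2q) (cancelling x-q), for which the equation fails; the claim about the explicit M assumes g(k) nonzero for all k>=1, as otherwise g=0 identically and M is undefined. *)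

theory Defs
  imports
    Complex_Main
    "HOL-Computational_Algebra.Polynomial_Factorial"
    "HOL-Computational_Algebra.Normalized_Fraction"
    "HOL-Computational_Algebra.Field_as_Ring"
    "HOL-Library.Groups_Big_Fun"
begin

section \<open>Infinite matrices\<close>

type_synonym inf_matrix = "nat \<Rightarrow> nat \<Rightarrow> complex"

text \<open>
  \<^const>\<open>Sum_any\<close> sums over the finite support of its argument. All products used below have a
  row-finite left factor, so this is the ordinary matrix product.
\<close>

definition mat_prod :: "inf_matrix \<Rightarrow> inf_matrix \<Rightarrow> inf_matrix"  (infixl \<open>\<odot>\<close> 70) where
  "A \<odot> B = (\<lambda>i j. Sum_any (\<lambda>k. A i k * B k j))"

definition lower_group :: "inf_matrix set" where
  "lower_group = {A. (\<forall>i j. i < j \<longrightarrow> A i j = 0) \<and> (\<forall>i. A i i \<noteq> 0)}"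

definition monic_matrix :: "inf_matrix \<Rightarrow> bool" where
  "monic_matrix A \<longleftrightarrow> (\<forall>i. A i i = 1)"

definition tridiagonals :: "inf_matrix set" where
  "tridiagonals = {L. (\<forall>i j. Suc i < j \<or> Suc j < i \<longrightarrow> L i j = 0) \<and>
                      (\<forall>k. L k (Suc k) \<noteq> 0 \<and> L (Suc k) k \<noteq> 0)}"

definition X_mat :: inf_matrix where
  "X_mat = (\<lambda>i j. if j = Suc i then 1 else 0)"

definition q_int :: "complex \<Rightarrow> int \<Rightarrow> complex" where
  "q_int q k = (q powi k - 1) / (q - 1)"

definition D_mat :: "complex \<Rightarrow> inf_matrix" where
  "D_mat q = (\<lambda>i j. if i = Suc j then q_int q (int j + 1) else 0)"

text \<open>The entry \<open>a 0\<close> is not used: the first subdiagonal is \<open>a 1, a 2, \<dots>\<close>.\<close>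

definition monic_tridiag :: "(nat \<Rightarrow> complex) \<Rightarrow> (nat \<Rightarrow> complex) \<Rightarrow> inf_matrix" where
  "monic_tridiag a b = (\<lambda>i j. if j = i then b i else if j = Suc i then 1
                              else if i = Suc j then a i else 0)"


section \<open>Matrices of orthogonal polynomials and the extended \<open>q\<close>-Hahn class\<close>

definition monic_poly_seq :: "(nat \<Rightarrow> complex poly) \<Rightarrow> bool" where
  "monic_poly_seq p \<longleftrightarrow> (\<forall>k. degree (p k) = k \<and> lead_coeff (p k) = 1)"

definition orthogonal_poly_seq :: "(nat \<Rightarrow> complex poly) \<Rightarrow> bool" where
  "orthogonal_poly_seq p \<longleftrightarrow>
     (\<exists>(\<mu> :: complex poly \<Rightarrow> complex) (\<gamma> :: nat \<Rightarrow> complex).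
        Vector_Spaces.linear smult (*) \<mu> \<and> (\<forall>k. \<gamma> k \<noteq> 0) \<and>
        (\<forall>k n. \<mu> (p k * p n) = (if k = n then \<gamma> k else 0)))"

definition MOP :: "inf_matrix set" where
  "MOP = {A. \<exists>p. monic_poly_seq p \<and> orthogonal_poly_seq p \<and> A = (\<lambda>k j. coeff (p k) j)}"

definition recurrence_matrix :: "inf_matrix \<Rightarrow> inf_matrix \<Rightarrow> bool" where
  "recurrence_matrix A L \<longleftrightarrow> L \<in> tridiagonals \<and> L \<odot> A = A \<odot> X_mat"

definition q_Hahn_equation :: "complex \<Rightarrow> inf_matrix \<Rightarrow> inf_matrix \<Rightarrow> complex \<Rightarrow> bool" where
  "q_Hahn_equation q L M t \<longleftrightarrow>
     (\<forall>i j. (L \<odot> L \<odot> D_mat q) i j - (q + 1) * (L \<odot> D_mat q \<odot> M) i j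
            + q * (D_mat q \<odot> (M \<odot> M)) i j = t * D_mat q i j)"

definition extended_q_Hahn :: "complex \<Rightarrow> inf_matrix set" where
  "extended_q_Hahn q = {A \<in> MOP. \<exists>L. recurrence_matrix A L \<and>
     (\<exists>M\<in>tridiagonals. \<exists>t. q_Hahn_equation q L M t)}"


section \<open>The rational functions \<open>Z\<close> and \<open>V\<close>\<close>

text \<open>
  The value at \<open>a\<close> of the quotient of the polynomials \<open>f\<close> and \<open>g\<close> in lowest terms. At a pole it is
  \<open>0\<close>, so that a nonzero value entails that there is no pole.
\<close>

definition cancelled_value :: "complex poly \<Rightarrow> complex poly \<Rightarrow> complex \<Rightarrow> complex" where
  "cancelled_value f g a = (case normalize_quot (f, g) of (n, d) \<Rightarrow> poly n a / poly d a)"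

definition k1 :: "'a::comm_ring_1 \<Rightarrow> 'a \<Rightarrow> 'a \<Rightarrow> 'a \<Rightarrow> 'a" where
  "k1 y d1 d2 d3 = y + d1 * d2 + d1 * d3 + d2 * d3"

definition k2 :: "'a::comm_ring_1 \<Rightarrow> 'a \<Rightarrow> 'a \<Rightarrow> 'a \<Rightarrow> 'a" where
  "k2 y d1 d2 d3 = y * (d1 + d2 + d3) + d1 * d2 * d3"

definition Z_num :: "'a::comm_ring_1 \<Rightarrow> 'a \<Rightarrow> 'a \<Rightarrow> 'a \<Rightarrow> 'a \<Rightarrow> 'a" where
  "Z_num y d1 d2 d3 x = (x - 1) * (x - y) *
     (((x - d1) * (d1 * x - y)) * ((x - d2) * (d2 * x - y)) * ((x - d3) * (d3 * x - y)))"

definition Z_den :: "'a::comm_ring_1 \<Rightarrow> 'a \<Rightarrow> 'a \<Rightarrow> 'a" where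
  "Z_den q y x = (x\<^sup>2 - q * y) * (x\<^sup>2 - y)\<^sup>2 * (q * x\<^sup>2 - y)"

definition V_num :: "'a::comm_ring_1 \<Rightarrow> 'a \<Rightarrow> 'a \<Rightarrow> 'a \<Rightarrow> 'a \<Rightarrow> 'a \<Rightarrow> 'a" where
  "V_num q y d1 d2 d3 x = (q * x - 1) * (k1 y d1 d2 d3 * q * x - k2 y d1 d2 d3)"

definition V_den :: "'a::comm_ring_1 \<Rightarrow> 'a \<Rightarrow> 'a \<Rightarrow> 'a" where
  "V_den q y x = (q - 1) * (q\<^sup>2 * x\<^sup>2 - y)"

text \<open>
  Both functions depend rationally on \<open>x\<close> and on the parameter \<open>y\<close>. They are only evaluated at
  points \<open>x = q ^ k\<close>, and common factors are cancelled after this substitution, in the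
  indeterminate \<open>y\<close> (the polynomial \<open>[:0, 1:]\<close>). If all \<open>Z(q ^ k)\<close>, \<open>k \<ge> 1\<close>, are finite and nonzero
  then \<open>y\<close> is none of \<open>q ^ 2, q ^ 3, \<dots>\<close>, and so the only cancellation that is ever needed is that of
  \<open>q - y\<close> in \<open>Z(q)\<close>, for \<open>y = q\<close>: there \<open>(q - y) / (q ^ 2 - q y) = 1 / q\<close>. Cancelling \<open>x - q\<close> in the
  quotient \<open>(x - q) / (x ^ 2 - q ^ 2)\<close> instead would give half of this value, for which the
  matrix equation of the theorem fails.
\<close>

definition Z :: "complex \<Rightarrow> complex \<Rightarrow> complex \<Rightarrow> complex \<Rightarrow> complex \<Rightarrow> complex \<Rightarrow> complex" where
  "Z q y d1 d2 d3 x = cancelled_value (Z_num [:0, 1:] [:d1:] [:d2:] [:d3:] [:x:])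
                                      (Z_den [:q:] [:0, 1:] [:x:]) y"

definition V :: "complex \<Rightarrow> complex \<Rightarrow> complex \<Rightarrow> complex \<Rightarrow> complex \<Rightarrow> complex \<Rightarrow> complex" where
  "V q y d1 d2 d3 x = cancelled_value (V_num [:q:] [:0, 1:] [:d1:] [:d2:] [:d3:] [:x:])
                                      (V_den [:q:] [:0, 1:] [:x:]) y"


section \<open>Basic facts\<close>

lemma cancelled_value_mult:
  assumes "h \<noteq> 0" "poly g a \<noteq> 0"
  shows "cancelled_value (h * f) (h * g) a = poly f a / poly g a"
proof -
  have g: "h * g \<noteq> 0" using assms by auto
  obtain n d where nd: "normalize_quot (h * f, h * g) = (n, d)" by fastforce
  obtain e where e: "h * f = n * e" "h * g = d * e" "e \<noteq> 0"
    by (rule normalize_quotE[OF g, of "h * f"]) (unfold nd fst_conv snd_conv)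
  have "h * e * (f * d) = h * e * (n * g)"
  proof -
    have "h * e * (f * d) = (h * f) * (d * e)" by (simp only: mult_ac)
    also have "\<dots> = (n * e) * (h * g)" by (simp only: e)
    finally show ?thesis by (simp only: mult_ac)
  qed
  with assms e have eq: "f * d = n * g" by simp
  have "coprime n d"
    using coprime_normalize_quot[of "(h * f, h * g)"] nd by simp
  moreover have "d dvd n * g" using eq by (metis dvd_triv_right)
  ultimately have "d dvd g" by (simp add: coprime_commute coprime_dvd_mult_right_iff)
  then obtain c where "g = d * c" by (rule dvdE)
  hence "poly d a \<noteq> 0" using assms(2) by simp
  moreover have "poly f a * poly d a = poly n a * poly g a"
    using eq by (metis poly_mult)
  ultimately show ?thesis
    using assms(2) nd by (simp add: cancelled_value_def frac_eq_eq)
qed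

lemma cancelled_value_eq:
  "poly g a \<noteq> 0 \<Longrightarrow> cancelled_value f g a = poly f a / poly g a"
  using cancelled_value_mult[of 1 g a f] by simp

lemmas poly_eval = poly_mult poly_add poly_diff poly_power poly_pCons poly_0 poly_1 mult_zero_left
  mult_zero_right add_0_left add_0_right mult_1_right

lemma Z_eq:
  assumes "Z_den q y x \<noteq> 0"
  shows "Z q y d1 d2 d3 x = Z_num y d1 d2 d3 x / Z_den q y x"
  using assms unfolding Z_def Z_num_def Z_den_def
  by (subst cancelled_value_eq) (simp_all only: poly_eval not_False_eq_True)

lemma V_eq:
  assumes "V_den q y x \<noteq> 0"
  shows "V q y d1 d2 d3 x = V_num q y d1 d2 d3 x / V_den q y x"
  using assms unfolding V_def V_num_def V_den_def k1_def k2_def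
  by (subst cancelled_value_eq) (simp_all only: poly_eval not_False_eq_True)

lemma Z_at_q:
  assumes "q \<noteq> 0" "(q\<^sup>2 - y)\<^sup>2 * (q * q\<^sup>2 - y) \<noteq> 0"
  shows "Z q y d1 d2 d3 q =
    (q - 1) * (((q - d1) * (d1 * q - y)) * ((q - d2) * (d2 * q - y)) * ((q - d3) * (d3 * q - y))) /
    (q * (q\<^sup>2 - y)\<^sup>2 * (q * q\<^sup>2 - y))"
proof -
  let ?Y = "[:0, 1:] :: complex poly"
  have "Z_num ?Y [:d1:] [:d2:] [:d3:] [:q:] = ([:q:] - ?Y) *
     (([:q:] - 1) * ((([:q:] - [:d1:]) * ([:d1:] * [:q:] - ?Y)) * (([:q:] - [:d2:]) * ([:d2:] * [:q:] - ?Y))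
        * (([:q:] - [:d3:]) * ([:d3:] * [:q:] - ?Y))))" (is "_ = _ * ?f")
    unfolding Z_num_def by (simp only: mult_ac)
  moreover have "Z_den [:q:] ?Y [:q:] = ([:q:] - ?Y) *
     ([:q:] * ([:q:]\<^sup>2 - ?Y)\<^sup>2 * ([:q:] * [:q:]\<^sup>2 - ?Y))" (is "_ = _ * ?g")
    unfolding Z_den_def by algebra
  moreover have "cancelled_value (([:q:] - ?Y) * ?f) (([:q:] - ?Y) * ?g) y = poly ?f y / poly ?g y"
  proof (rule cancelled_value_mult)
    show "poly ?g y \<noteq> 0" using assms by (simp only: poly_eval) simp
  qed simp
  ultimately have "Z q y d1 d2 d3 q = poly ?f y / poly ?g y"
    unfolding Z_def by (simp only:)
  thus ?thesis
    by (simp only: poly_eval)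
qed

lemma Sum_any_tridiag:
  assumes "\<forall>k. Suc i < k \<or> Suc k < i \<longrightarrow> f k = (0 :: complex)"
  shows "Sum_any f = sum f {..Suc i}"
  using assms by (intro Sum_any.expand_superset) (auto intro!: leI)

lemma mat_prod_X [simp]:
  "(A \<odot> X_mat) i j = (if j = 0 then 0 else A i (j - 1))"
proof -
  have "(A \<odot> X_mat) i j = sum (\<lambda>k. A i k * X_mat k j) {j - 1}"
    unfolding mat_prod_def X_mat_def by (rule Sum_any.expand_superset) auto
  thus ?thesis by (auto simp: X_mat_def)
qed

lemma monic_tridiag_prod:
  "(monic_tridiag a b \<odot> A) i j =
     A (Suc i) j + b i * A i j + (if i = 0 then 0 else a i * A (i - 1) j)"
proof -
  have "(monic_tridiag a b \<odot> A) i j = sum (\<lambda>k. monic_tridiag a b i k * A k j) {..Suc i}"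
    unfolding mat_prod_def by (intro Sum_any_tridiag) (auto simp: monic_tridiag_def)
  also have "\<dots> = A (Suc i) j + b i * A i j + (if i = 0 then 0 else a i * A (i - 1) j)"
  proof (cases i)
    case (Suc m)
    have "sum (\<lambda>k. monic_tridiag a b i k * A k j) {..<m} = 0"
      by (intro sum.neutral) (auto simp: monic_tridiag_def Suc)
    moreover have "{..Suc i} = insert (Suc i) (insert i (insert m {..<m}))"
      by (auto simp: Suc)
    ultimately show ?thesis
      by (simp add: Suc monic_tridiag_def algebra_simps)
  qed (simp add: monic_tridiag_def)
  finally show ?thesis .
qed

fun assoc_matrix :: "(nat \<Rightarrow> complex) \<Rightarrow> (nat \<Rightarrow> complex) \<Rightarrow> inf_matrix" where
  "assoc_matrix a b 0 j = (if j = 0 then 1 else 0)"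
| "assoc_matrix a b (Suc i) j =
     (if j = 0 then 0 else assoc_matrix a b i (j - 1)) - b i * assoc_matrix a b i j
     - (if i = 0 then 0 else a i * assoc_matrix a b (i - 1) j)"

lemma assoc_matrix_lower:
  "(i < j \<longrightarrow> assoc_matrix a b i j = 0) \<and> assoc_matrix a b i i = 1"
proof (induction i arbitrary: j rule: less_induct)
  case (less i)
  show ?case
  proof (cases i)
    case (Suc m)
    have "assoc_matrix a b m k = 0" if "m < k" for k using less[of m k] that Suc by simp
    moreover have "assoc_matrix a b (m - 1) k = 0" if "m < k" for k
      using less[of "m - 1" k] that Suc by simp
    moreover have "assoc_matrix a b m m = 1" using less[of m] Suc by simp
    ultimately show ?thesis using Suc by auto
  qed simp
qed

text \<open>The matrix \<open>A\<close> of the theorem exists and is unique.\<close>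

lemma ex1_monic_matrix:
  "\<exists>!A. A \<in> lower_group \<and> monic_matrix A \<and> monic_tridiag a b \<odot> A = A \<odot> X_mat"
proof (rule ex1I)
  show "assoc_matrix a b \<in> lower_group \<and> monic_matrix (assoc_matrix a b) \<and>
        monic_tridiag a b \<odot> assoc_matrix a b = assoc_matrix a b \<odot> X_mat"
    using assoc_matrix_lower[of _ _ a b]
    by (auto simp: lower_group_def monic_matrix_def fun_eq_iff monic_tridiag_prod)
next
  fix A
  assume A: "A \<in> lower_group \<and> monic_matrix A \<and> monic_tridiag a b \<odot> A = A \<odot> X_mat"
  have rec: "A (Suc i) j = (if j = 0 then 0 else A i (j - 1)) - b i * A i j
               - (if i = 0 then 0 else a i * A (i - 1) j)" for i j
    using fun_cong[OF fun_cong[OF A[THEN conjunct2, THEN conjunct2], of i], of j]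
    unfolding monic_tridiag_prod mat_prod_X by (simp add: algebra_simps)
  have "A i j = assoc_matrix a b i j" for i j
  proof (induction i arbitrary: j rule: less_induct)
    case (less i)
    show ?case
    proof (cases i)
      case 0
      then show ?thesis using A by (auto simp: lower_group_def monic_matrix_def)
    next
      case (Suc m)
      then have "A m x = assoc_matrix a b m x" "A (m - 1) x = assoc_matrix a b (m - 1) x" for x
        by (auto intro: less)
      then show ?thesis unfolding Suc rec assoc_matrix.simps by (simp only:)
    qed
  qed
  thus "A = assoc_matrix a b" by (simp add: fun_eq_iff)
qed

text \<open>
  The matrix of recurrence coefficients is determined by \<open>A\<close>, so the existential quantifier over
  \<open>L\<close> in \<^const>\<open>extended_q_Hahn\<close> refers to the unique such matrix.
\<close>

lemma recurrence_matrix_unique: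
  assumes A: "A \<in> lower_group" and L: "recurrence_matrix A L" "recurrence_matrix A L'"
  shows "L = L'"
proof -
  have tri: "L i k = L' i k" if "Suc i < k" for i k
    using L that by (simp add: recurrence_matrix_def tridiagonals_def)
  have prod: "(N \<odot> A) i j = sum (\<lambda>k. N i k * A k j) {..Suc i}" if "N \<in> tridiagonals" for N i j
    using that unfolding mat_prod_def
    by (intro Sum_any_tridiag) (auto simp: tridiagonals_def)
  have eq: "sum (\<lambda>k. (L i k - L' i k) * A k j) {..Suc i} = 0" for i j
    using L prod[of L i j] prod[of L' i j]
    by (simp add: recurrence_matrix_def left_diff_distrib sum_subtractf)
  have "L i k = L' i k" if "k \<le> Suc i" for i k
    using that
  proof (induction "Suc i - k" arbitrary: k rule: less_induct)
    case less
    have "(\<Sum>m\<le>Suc i. (L i m - L' i m) * A m k) = (\<Sum>m\<in>{k}. (L i m - L' i m) * A m k)"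
    proof (rule sum.mono_neutral_right)
      show "\<forall>m\<in>{..Suc i} - {k}. (L i m - L' i m) * A m k = 0"
      proof
        fix m assume m: "m \<in> {..Suc i} - {k}"
        show "(L i m - L' i m) * A m k = 0"
        proof (cases "m < k")
          case True
          then show ?thesis using A by (simp add: lower_group_def)
        next
          case False
          with m have "Suc i - m < Suc i - k" "m \<le> Suc i" by auto
          then show ?thesis by (simp add: less.hyps)
        qed
      qed
    qed (use less.prems in auto)
    thus ?case using eq[of i k] A by (simp add: lower_group_def)
  qed
  thus ?thesis using tri by (metis ext not_le)
qed

end

theory Submission
  imports Defs
begin

text \<open>
  Write \<open>[k]\<close> for \<^term>\<open>q_int q k\<close> and \<open>\<sigma>\<^sub>k = [k+1] w\<^sub>k\<close>, so that \<open>w\<^sub>k\<close> is a multiple of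
  \<open>(k\<^sub>1 q\<^sup>k\<^sup>+\<^sup>1 - k\<^sub>2) / (q\<^sup>2\<^sup>k\<^sup>+\<^sup>2 - y)\<close>. The second-order recurrence satisfied by the numerators shows that
  \<open>g(k)\<close> is a constant multiple of \<open>q\<^sup>k\<^sup>+\<^sup>1 - y\<close>. Replacing \<open>g(k+1) / g(k)\<close> by
  \<open>(q\<^sup>k\<^sup>+\<^sup>2 - y) / (q\<^sup>k\<^sup>+\<^sup>1 - y)\<close> gives a matrix that solves the equation even when \<open>g\<close> vanishes
  identically. The equation then decouples into one scalar identity in \<open>x = q\<^sup>i\<close> for each of five
  diagonals. The only deep one is that on the subdiagonal: after cancelling \<open>x - 1\<close>, \<open>x - y\<close> and the
  outer factors of the denominators of \<open>Z(x)\<close> and \<open>Z(q x)\<close>, and factoring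
  \<open>\<beta>\<^sup>2 - (q+1) \<beta> \<beta>' + q \<beta>'\<^sup>2 = (\<beta> - \<beta>') (\<beta> - q \<beta>')\<close>, it becomes a polynomial identity in \<open>q\<close>, \<open>x\<close>, \<open>y\<close>
  and the \<open>d\<^sub>j\<close>. That \<open>A\<close> is a matrix of orthogonal polynomials is Favard's theorem.
\<close>

section \<open>Favard's theorem\<close>

text \<open>The moments of the functional of orthogonality, normalised to total mass 1. Row n is the
  coefficient list of the n-th polynomial; for a monic \<open>A\<close>, the condition that this
  polynomial has mean 0 can be solved for the n-th moment.\<close>

fun moments :: "inf_matrix \<Rightarrow> nat \<Rightarrow> complex" where
  "moments A n = (if n = 0 then 1 else - (\<Sum>j<n. A n j * moments A j))"

declare moments.simps [simp del]

text \<open>The moment functional vanishes on \<open>p n\<close> for n > 0. Multiplication by x can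
  be moved between the factors of \<open>p k * p n\<close>, so the recurrence lowers k until this
  applies.\<close>

lemma MOP_if_recurrence:
  assumes A: "A \<in> lower_group" "monic_matrix A"
    and rec: "monic_tridiag a b \<odot> A = A \<odot> X_mat"
    and a: "\<And>k. k \<ge> 1 \<Longrightarrow> a k \<noteq> 0"
  shows "A \<in> MOP"
proof -
  define p where "p k = (\<Sum>j\<le>k. monom (A k j) j)" for k
  have coeff_p: "coeff (p k) j = A k j" for k j
    using A(1) by (auto simp: p_def coeff_sum lower_group_def)
  have diag: "A k k = 1" and upper: "i < j \<Longrightarrow> A i j = 0" for i j k
    using A by (auto simp: monic_matrix_def lower_group_def)
  have deg: "degree (p k) = k" for k
  proof (rule antisym)
    show "degree (p k) \<le> k" by (rule degree_le) (simp add: coeff_p upper)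
    show "k \<le> degree (p k)" by (rule le_degree) (simp add: coeff_p diag)
  qed
  have monic: "monic_poly_seq p"
    by (simp add: monic_poly_seq_def deg coeff_p diag)
  have p0: "p 0 = 1"
    by (simp add: p_def diag monom_0 one_pCons)
  have p_rec: "p (Suc k) + smult (b k) (p k) + (if k = 0 then 0 else smult (a k) (p (k - 1)))
      = pCons 0 (p k)" for k
  proof (rule poly_eqI)
    fix j
    show "coeff (p (Suc k) + smult (b k) (p k) + (if k = 0 then 0 else smult (a k) (p (k - 1)))) j
      = coeff (pCons 0 (p k)) j"
      using fun_cong[OF fun_cong[OF rec, of k], of j]
      by (cases j) (auto simp: coeff_p monic_tridiag_prod)
  qed
  \<comment> \<open>the moments are chosen such that \<open>\<mu> (p n) = 0\<close> for \<open>n > 0\<close>\<close>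
  define \<mu> where "\<mu> f = (\<Sum>i\<le>degree f. coeff f i * moments A i)" for f
  \<comment> \<open>The range of the sum in \<open>\<mu>\<close> depends on its argument; a common
    longer range makes additivity a termwise statement.\<close>
  have \<mu>_eq: "\<mu> f = (\<Sum>i\<le>n. coeff f i * moments A i)" if "degree f \<le> n" for f n
    unfolding \<mu>_def using that
    by (intro sum.mono_neutral_left) (auto simp: coeff_eq_0)
  have \<mu>_add: "\<mu> (f + h) = \<mu> f + \<mu> h" for f h
    using \<mu>_eq[of f "max (degree f) (degree h)"] \<mu>_eq[of h "max (degree f) (degree h)"]
      \<mu>_eq[of "f + h" "max (degree f) (degree h)"]
    by (simp add: degree_add_le_max sum.distrib algebra_simps)
  have \<mu>_smult: "\<mu> (smult c f) = c * \<mu> f" for c f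
    using \<mu>_eq[of "smult c f" "degree f"] by (simp add: \<mu>_def sum_distrib_left mult.assoc)
  have \<mu>_0: "\<mu> 0 = 0" by (simp add: \<mu>_def)
  have lin: "Vector_Spaces.linear smult (*) \<mu>"
    by unfold_locales (auto simp: \<mu>_add \<mu>_smult algebra_simps smult_add_right smult_add_left)
  have \<mu>_p: "\<mu> (p n) = (if n = 0 then 1 else 0)" for n
  proof -
    have "\<mu> (p n) = (\<Sum>j<n. A n j * moments A j) + moments A n"
      by (simp add: \<mu>_def deg coeff_p diag lessThan_Suc_atMost[symmetric])
    then show ?thesis by (subst (asm) (2) moments.simps) auto
  qed
  \<comment> \<open>In the value at n = k = m + 1 only the term
    \<open>a n * \<mu> (p m * p m)\<close> of \<open>mu_shift\<close> survives, which forces this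
    product.\<close>
  define \<gamma> where "\<gamma> k = (\<Prod>i=1..k. a i)" for k
  have mu_rec: "\<mu> (p (Suc k) * h) = \<mu> (pCons 0 (p k) * h) - b k * \<mu> (p k * h)
      - (if k = 0 then 0 else a k * \<mu> (p (k - 1) * h))" for k h
    unfolding p_rec[of k, symmetric]
    by (auto simp: \<mu>_0 \<mu>_add \<mu>_smult distrib_right)
  have mu_shift: "\<mu> (pCons 0 (p k) * p n) = \<mu> (p k * p (Suc n)) + b n * \<mu> (p k * p n)
      + (if n = 0 then 0 else a n * \<mu> (p k * p (n - 1)))" for k n
  proof -
    have "pCons 0 (p k) * p n = p k * pCons 0 (p n)" by simp
    then show ?thesis
      unfolding p_rec[of n, symmetric] by (auto simp: \<mu>_0 \<mu>_add \<mu>_smult distrib_left)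
  qed
  have \<mu>_pp: "\<mu> (p k * p n) = (if k = n then \<gamma> k else 0)" for k n
  proof (induction k arbitrary: n rule: less_induct)
    case (less k)
    show ?case
    proof (cases k)
      case 0
      then show ?thesis by (simp add: p0 \<mu>_p \<gamma>_def)
    next
      case (Suc m)
      have IH: "\<mu> (p m * p n) = (if m = n then \<gamma> m else 0)"
        "m \<noteq> 0 \<Longrightarrow> \<mu> (p (m - 1) * p n) = (if m - 1 = n then \<gamma> (m - 1) else 0)" for n
        using less Suc by auto
      have \<gamma>_Suc: "\<gamma> (Suc i) = \<gamma> i * a (Suc i)" for i by (simp add: \<gamma>_def)
      \<comment> \<open>Only n = m - 1, m, m + 1 contribute. For n = m the two \<open>b\<close>
        terms cancel, for n = m - 1 the terms \<open>\<gamma> m\<close> and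
        \<open>a m * \<gamma> (m - 1)\<close> do.\<close>
      show ?thesis
        unfolding Suc mu_rec mu_shift
        by (insert IH, cases m; cases n; auto simp: \<gamma>_Suc)
    qed
  qed
  have "\<gamma> k \<noteq> 0" for k using a by (auto simp: \<gamma>_def)
  then have "orthogonal_poly_seq p"
    unfolding orthogonal_poly_seq_def using lin \<mu>_pp by blast
  then show ?thesis
    unfolding MOP_def using monic coeff_p by (force simp: fun_eq_iff)
qed

section \<open>The matrix equation, diagonal by diagonal\<close>

lemma mat_prod_D_mat: "(B \<odot> D_mat q) i j = B i (Suc j) * q_int q (int j + 1)"
proof -
  have "(B \<odot> D_mat q) i j = sum (\<lambda>k. B i k * D_mat q k j) {Suc j}"
    unfolding mat_prod_def D_mat_def by (rule Sum_any.expand_superset) auto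
  thus ?thesis by (simp add: D_mat_def)
qed

lemma D_mat_mat_prod: "(D_mat q \<odot> B) i j = (if i = 0 then 0 else q_int q (int i) * B (i - 1) j)"
proof -
  have "(D_mat q \<odot> B) i j = sum (\<lambda>k. D_mat q i k * B k j) {i - 1}"
    unfolding mat_prod_def D_mat_def by (rule Sum_any.expand_superset) auto
  thus ?thesis by (auto simp: D_mat_def)
qed

lemma monic_tridiag_D_mat_prod:
  "(monic_tridiag a b \<odot> D_mat q \<odot> B) i j =
     q_int q (int i + 1) * B i j + (if i = 0 then 0 else b i * q_int q (int i) * B (i - 1) j)
     + (if i < 2 then 0 else a i * q_int q (int i - 1) * B (i - 2) j)"
proof -
  have "(monic_tridiag a b \<odot> D_mat q \<odot> B) i j
      = sum (\<lambda>k. monic_tridiag a b i (Suc k) * q_int q (int k + 1) * B k j) {..i}"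
    unfolding mat_prod_def[of "monic_tridiag a b \<odot> D_mat q"] mat_prod_D_mat
    by (rule Sum_any.expand_superset)
       (auto simp: monic_tridiag_def split: if_splits intro!: leI)
  also have "\<dots> = q_int q (int i + 1) * B i j
      + (if i = 0 then 0 else b i * q_int q (int i) * B (i - 1) j)
      + (if i < 2 then 0 else a i * q_int q (int i - 1) * B (i - 2) j)"
  proof -
    consider "i = 0" | "i = 1" | m where "i = Suc (Suc m)"
      by (metis One_nat_def not0_implies_Suc)
    then show ?thesis
    proof cases
      case 3
      have "(\<Sum>k<m. monic_tridiag a b i (Suc k) * q_int q (int k + 1) * B k j) = 0"
        by (intro sum.neutral) (auto simp: monic_tridiag_def 3)
      moreover have "{..i} = insert i (insert (Suc m) (insert m {..<m}))"
        by (auto simp: 3)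
      ultimately show ?thesis by (simp add: 3 monic_tridiag_def add_ac)
    qed (simp_all add: monic_tridiag_def)
  qed
  finally show ?thesis .
qed

lemma q_int_of_nat: "q_int q (int n) = (q ^ n - 1) / (q - 1)"
  by (simp add: q_int_def)

text \<open>\<open>[n]\<close> is a combination of 1 and \<open>q ^ n\<close>, and 1 and q are the
  roots of \<open>X^2 - (q + 1) X + q\<close>. This is the matrix equation on the
  superdiagonal.\<close>

lemma q_int_rec:
  fixes n :: nat
  shows "q_int q (int (Suc (Suc n))) - (q + 1) * q_int q (int (Suc n)) + q * q_int q (int n) = 0"
  by (simp only: q_int_of_nat power_Suc diff_divide_distrib) (simp add: algebra_simps add_divide_distrib)

text \<open>All three products live on the diagonals with row minus column between -1 and 3. The
  superdiagonal is \<open>q_int_rec\<close>; the other four diagonals are the hypotheses, numbered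
  from the subdiagonal that carries \<open>D_mat\<close>: \<open>diag1\<close> is the main diagonal,
  \<open>diag_m1\<close> and \<open>diag_m2\<close> lie below. In \<open>diag1\<close> the value
  \<open>b' (i - 1)\<close> is harmless at i = 0 because \<open>e 0 = 0\<close>.\<close>

lemma q_Hahn_equation_monic_tridiagI:
  fixes a b a' b' :: "nat \<Rightarrow> complex" and q t :: complex
  defines "e \<equiv> \<lambda>n. q_int q (int n)"
  assumes diag1: "\<And>i. e (Suc i) * (b (Suc i) + b i) - (q + 1) * (e (Suc i) * b' i + e i * b i)
       + q * e i * (b' i + b' (i - 1)) = 0"
    and diag0: "\<And>i. e (Suc i) * (a (Suc (Suc i)) + (b (Suc i))\<^sup>2 + a (Suc i))
       - (q + 1) * (e (Suc (Suc i)) * a' (Suc i) + e (Suc i) * b (Suc i) * b' i + e i * a (Suc i))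
       + q * e (Suc i) * (a' (Suc i) + (b' i)\<^sup>2 + (if i = 0 then 0 else a' i)) = t * e (Suc i)"
    and diag_m1: "\<And>i. e (Suc i) * a (Suc (Suc i)) * (b (Suc (Suc i)) + b (Suc i))
       - (q + 1) * (e (Suc (Suc i)) * b (Suc (Suc i)) * a' (Suc i) + e (Suc i) * a (Suc (Suc i)) * b' i)
       + q * e (Suc (Suc i)) * a' (Suc i) * (b' (Suc i) + b' i) = 0"
    and diag_m2: "\<And>i. e (Suc i) * a (Suc (Suc (Suc i))) * a (Suc (Suc i))
       - (q + 1) * e (Suc (Suc i)) * a (Suc (Suc (Suc i))) * a' (Suc i)
       + q * e (Suc (Suc (Suc i))) * a' (Suc (Suc i)) * a' (Suc i) = 0"
  shows "q_Hahn_equation q (monic_tridiag a b) (monic_tridiag a' b') t"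
proof -
  let ?L = "monic_tridiag a b" and ?M = "monic_tridiag a' b'"
  have e0: "q_int q 0 = 0" "e 0 = 0" by (simp_all add: e_def q_int_def)
  have e: "q_int q (int k + 1) = e (Suc k)" "q_int q (int k) = e k" "q_int q (1 + int k) = e (Suc k)"
    "q_int q 1 = e 1" for k
    by (simp_all add: e_def add.commute)
  have e': "q_int q (int (Suc k) - 1) = e k" for k by (simp add: e_def)
  have e_rec: "e (Suc (Suc n)) - (q + 1) * e (Suc n) + q * e n = 0" for n
    unfolding e_def by (rule q_int_rec)
  have D_e: "D_mat q i j = (if i = Suc j then e (Suc j) else 0)" for i j
    by (simp add: D_mat_def e_def add.commute)
  define lhs where "lhs i j = (?L \<odot> ?L \<odot> D_mat q) i j - (q + 1) * (?L \<odot> D_mat q \<odot> ?M) i j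
            + q * (D_mat q \<odot> (?M \<odot> ?M)) i j" for i j
  note lhs_simps = lhs_def mat_prod_D_mat monic_tridiag_D_mat_prod D_mat_mat_prod monic_tridiag_prod
    e e' e0 D_e
  have lhs1: "lhs (Suc j) j = t * D_mat q (Suc j) j" for j
    using diag0[of j]
    by (cases j) (simp_all only: lhs_simps, simp_all add: monic_tridiag_def e0 power2_eq_square algebra_simps)
  have lhs2: "lhs j j = t * D_mat q j j" for j
  proof -
    consider "j = 0" | "j = Suc 0" | m where "j = Suc (Suc m)"
      by (metis not0_implies_Suc)
    then show ?thesis
      using diag1[of j]
      by cases (simp_all only: lhs_simps, simp_all add: monic_tridiag_def e0 algebra_simps)
  qed
  have lhs3: "lhs i j = t * D_mat q i j" if "j > i" for i j
  proof -
    consider "i = 0" | "i = Suc 0" | m where "i = Suc (Suc m)"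
      by (metis not0_implies_Suc)
    then show ?thesis
      using that e_rec[of i]
      by cases (simp_all only: lhs_simps, auto simp add: monic_tridiag_def e0 algebra_simps)
  qed
  have lhs4: "lhs (Suc (Suc j)) j = t * D_mat q (Suc (Suc j)) j" for j
    using diag_m1[of j]
    by (simp only: lhs_simps) (simp add: monic_tridiag_def e0 algebra_simps)
  have lhs5: "lhs i j = t * D_mat q i j" if gt: "i > Suc (Suc j)" for i j
  proof -
    define m where "m = i - 3"
    have i: "i = Suc (Suc (Suc m))" using gt by (simp add: m_def)
    consider "j = m" | "j < m" using gt i by linarith
    then show ?thesis
      using diag_m2[of m]
      by cases (simp_all only: lhs_simps i, simp_all add: monic_tridiag_def e0 algebra_simps)
  qed
  have "lhs i j = t * D_mat q i j" for i j
  proof -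
    consider "i = Suc j" | "i = j" | "i < j" | "i = Suc (Suc j)" | "Suc (Suc j) < i" by linarith
    then show ?thesis
      by cases (use lhs1[of j] lhs2[of j] lhs3[of i j] lhs4[of j] lhs5[of j i] in blast)+
  qed
  then show ?thesis by (simp add: q_Hahn_equation_def lhs_def)
qed

section \<open>The scalar identities\<close>

text \<open>The cleared form of the equation on the subdiagonal that carries \<open>D_mat\<close>:
  \<open>P\<close> is what \<open>Z_num\<close> leaves without (x - 1)(x - y), \<open>v\<close>
  gives the numerators of \<open>w\<close>, and the last summand comes from
  \<open>t\<close>.\<close>

lemma q_Hahn_identity:
  fixes q x y a b c :: complex
  defines "P \<equiv> \<lambda>x. (x - a) * (a * x - y) * ((x - b) * (b * x - y)) * ((x - c) * (c * x - y))"
  defines "D1 \<equiv> x\<^sup>2 - y" and "D2 \<equiv> q * x\<^sup>2 - y" and "D3 \<equiv> q\<^sup>2 * x\<^sup>2 - y"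
  defines "v \<equiv> \<lambda>x. k1 y a b c * x - k2 y a b c"
  shows "q * (q - 1) * P x * D3\<^sup>2 - (q - 1) * P (q * x) * D1\<^sup>2
    + q * x * D2 * (q * v (q * x) * D1 - v x * D3) * (v (q * x) * D1 - v x * D3)
    + (q - 1)\<^sup>2 * (a * b * c) * D1\<^sup>2 * D2 * D3\<^sup>2 = 0"
  unfolding assms k1_def k2_def by algebra

text \<open>This holds for every sequence \<open>w\<close>: the coefficient of \<open>w i\<close>
  cancels outright, those of \<open>w (i + 1)\<close> and \<open>w (i - 1)\<close> are multiples of
  \<open>e_rec\<close>.\<close>

lemma diag1_identity:
  fixes e :: "nat \<Rightarrow> complex"
  assumes e_rec: "\<And>n. e (Suc (Suc n)) - (q + 1) * e (Suc n) + q * e n = 0" and "e 0 = 0"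
    and b: "\<And>k. b k = e (Suc k) * w k - e k * w (k - 1)"
    and b': "\<And>k. b' k = e (Suc k) * w (Suc k) - e k * w k"
  shows "e (Suc i) * (b (Suc i) + b i) - (q + 1) * (e (Suc i) * b' i + e i * b i)
       + q * e i * (b' i + b' (i - 1)) = 0"
proof (cases i)
  case 0
  then show ?thesis using e_rec[of 0] assms(2) by (simp add: b b')
next
  case (Suc m)
  define e0 e1 e2 e3 where "e0 = e m" "e1 = e (Suc m)" "e2 = e (Suc (Suc m))"
    "e3 = e (Suc (Suc (Suc m)))"
  define w0 w1 w2 where "w0 = w m" "w1 = w (Suc m)" "w2 = w (Suc (Suc m))"
  have "e2 * ((e3 * w2 - e2 * w1) + (e2 * w1 - e1 * w0))
      - (q + 1) * (e2 * (e2 * w2 - e1 * w1) + e1 * (e2 * w1 - e1 * w0))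
      + q * e1 * ((e2 * w2 - e1 * w1) + (e1 * w1 - e0 * w0)) = 0"
    using e_rec[of m, folded e0_e1_e2_e3_def] e_rec[of "Suc m", folded e0_e1_e2_e3_def] by algebra
  then show ?thesis by (simp add: b b' Suc e0_e1_e2_e3_def w0_w1_w2_def)
qed

text \<open>Eliminating \<open>A1'\<close> and \<open>A2'\<close> leaves
  \<open>q (x - y) - (q + 1) (q x - y) + (q^2 x - y)\<close>, which is 0.\<close>

lemma diag_m2_identity:
  fixes q x y E1 E2 E3 A2 A3 A1' A2' :: complex
  assumes "q \<noteq> 0" "E2 \<noteq> 0" "E3 \<noteq> 0" "q * x \<noteq> y" "x \<noteq> y"
    and "A1' * (E2 * (q * (x - y))) = E1 * (q * x - y) * A2"
    and "A2' * (E3 * (q * (q * x - y))) = E2 * (q\<^sup>2 * x - y) * A3"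
  shows "E1 * A3 * A2 - (q + 1) * E2 * A3 * A1' + q * E3 * A2' * A1' = 0"
proof -
  have "(E1 * A3 * A2 - (q + 1) * E2 * A3 * A1' + q * E3 * A2' * A1')
     * (E2 * E3 * (q * (x - y)) * (q * (q * x - y))) = 0"
    using assms(6,7) by algebra
  then show ?thesis using assms by simp
qed

text \<open>Once \<open>A1'\<close> is eliminated, the factor left over is linear in the
  \<open>w\<close> values and turns out to be minus the recurrence \<open>N\<close> of their
  numerators.\<close>

lemma diag_m1_identity:
  fixes q y z E0 E1 E2 E3 A2 A1' w0 w1 w2 :: complex
  assumes "q \<noteq> 0" "q \<noteq> 1" "q\<^sup>2 * z \<noteq> y"
    and A: "A1' * (E2 * (q * (q\<^sup>2 * z - y))) = E1 * (q^3 * z - y) * A2"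
    and N: "q * N0 - (q + 1) * N1 + N2 = 0"
    and w: "w0 * (q\<^sup>2 * z\<^sup>2 - y) = N0" "w1 * (q^4 * z\<^sup>2 - y) = N1" "w2 * (q^6 * z\<^sup>2 - y) = N2"
    and E: "(q - 1) * E0 = z - 1" "(q - 1) * E1 = q * z - 1" "(q - 1) * E2 = q\<^sup>2 * z - 1"
      "(q - 1) * E3 = q^3 * z - 1"
    and b: "b2 = E3 * w2 - E2 * w1" "b1 = E2 * w1 - E1 * w0"
    and b': "b1' = E2 * w2 - E1 * w1" "b0' = E1 * w1 - E0 * w0"
  shows "E1 * A2 * (b2 + b1) - (q + 1) * (E2 * b2 * A1' + E1 * A2 * b0')
       + q * E2 * A1' * (b1' + b0') = 0"
proof -
  define B where "B = (b2 + b1 - (q + 1) * b0') * (q * (q\<^sup>2 * z - y))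
    + (q^3 * z - y) * (- (q + 1) * b2 + q * (b1' + b0'))"
  \<comment> \<open>The factor \<open>q - 1\<close> turns each \<open>E\<close> into a polynomial in
    q and z.\<close>
  have "(q - 1) * B = - (q - 1) * (q * (w0 * (q\<^sup>2 * z\<^sup>2 - y)) - (q + 1) * (w1 * (q^4 * z\<^sup>2 - y))
      + w2 * (q^6 * z\<^sup>2 - y))"
    unfolding B_def b b' using E by algebra
  then have "B = 0" using assms by simp
  have "(E1 * A2 * (b2 + b1) - (q + 1) * (E2 * b2 * A1' + E1 * A2 * b0')
       + q * E2 * A1' * (b1' + b0')) * (q * (q\<^sup>2 * z - y)) = E1 * A2 * B"
    unfolding B_def using A by algebra
  with \<open>B = 0\<close> show ?thesis using assms by simp
qed

text \<open>Eliminating \<open>A1'\<close> produces the factor \<open>q^3 x^2 - y\<close>, which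
  cancels the last factor of \<open>Z_den\<close> at \<open>q * x\<close>; the numerator loses (q x
  - 1)(q x - y).\<close>

lemma diag0_upper_part:
  fixes q x y s E1 E2 A2 A1' P :: complex
  assumes "q \<noteq> 1" "E2 \<noteq> 0" "q * x \<noteq> y"
    and A': "A1' * (E2 * (q * (q * x - y))) = E1 * (q\<^sup>2 * x - y) * A2"
    and A: "A2 * (q * ((q * x\<^sup>2 - y) * (q\<^sup>2 * x\<^sup>2 - y)\<^sup>2 * (q^3 * x\<^sup>2 - y)))
      = s\<^sup>2 * ((q * x - 1) * (q * x - y) * P)"
    and E: "(q - 1) * E1 = x - 1" "(q - 1) * E2 = q * x - 1"
  shows "(E1 * A2 - (q + 1) * (E2 * A1') + q * E1 * A1') * (q\<^sup>2 * (q * x\<^sup>2 - y) * (q\<^sup>2 * x\<^sup>2 - y)\<^sup>2)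
    = - E1 * s\<^sup>2 * (q - 1) * P"
proof -
  have "(E1 * A2 - (q + 1) * (E2 * A1') + q * E1 * A1') * (E2 * (q * (q * x - y)))
     = - (E1 * (q^3 * x\<^sup>2 - y) * A2)"
  proof -
    have "(q - 1) * ((E1 * A2 - (q + 1) * (E2 * A1') + q * E1 * A1') * (E2 * (q * (q * x - y))))
      = E1 * A2 * (((q - 1) * E2) * (q * (q * x - y)) + (q\<^sup>2 * x - y) * (q * ((q - 1) * E1) - (q + 1) * ((q - 1) * E2)))"
      using A' by algebra
    also have "\<dots> = (q - 1) * (- (E1 * (q^3 * x\<^sup>2 - y) * A2))"
      unfolding E by algebra
    finally show ?thesis using \<open>q \<noteq> 1\<close> by (simp only: mult_cancel_left) simp
  qed
  then have "(E1 * A2 - (q + 1) * (E2 * A1') + q * E1 * A1') * (q\<^sup>2 * (q * x\<^sup>2 - y) * (q\<^sup>2 * x\<^sup>2 - y)\<^sup>2)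
    * (E2 * (q * x - y)) = - E1 * (A2 * (q * ((q * x\<^sup>2 - y) * (q\<^sup>2 * x\<^sup>2 - y)\<^sup>2 * (q^3 * x\<^sup>2 - y))))"
    by algebra
  also have "\<dots> = (- E1 * s\<^sup>2 * (q - 1) * P) * (E2 * (q * x - y))"
    unfolding A E(2)[symmetric] by (simp add: mult_ac)
  finally show ?thesis using assms(2,3) by (simp only: mult_cancel_right) simp
qed

text \<open>The counterpart for the other two off-diagonal coefficients: here the factor produced is
  \<open>q (q z^2 - y)\<close>, the first one of \<open>Z_den\<close> at
  \<open>q * z\<close>.\<close>

lemma diag0_lower_part:
  fixes q z y s E0 E1 A1 A0' P :: complex
  assumes "q \<noteq> 1" "E1 \<noteq> 0" "q * z \<noteq> y"
    and A': "A0' * (E1 * (q * (q * z - y))) = E0 * (q\<^sup>2 * z - y) * A1"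
    and A: "A1 * (q * ((q * z\<^sup>2 - y) * (q\<^sup>2 * z\<^sup>2 - y)\<^sup>2 * (q^3 * z\<^sup>2 - y)))
      = s\<^sup>2 * ((q * z - 1) * (q * z - y) * P)"
    and E: "(q - 1) * E0 = z - 1" "(q - 1) * E1 = q * z - 1"
  shows "(E1 * A1 - (q + 1) * (E0 * A1) + q * E1 * A0') * (q * (q\<^sup>2 * z\<^sup>2 - y)\<^sup>2 * (q^3 * z\<^sup>2 - y))
    = E1 * s\<^sup>2 * (q - 1) * P"
proof -
  have "(E1 * A1 - (q + 1) * (E0 * A1) + q * E1 * A0') * (E1 * (q * (q * z - y)))
     = E1 * (q * (q * z\<^sup>2 - y)) * A1"
  proof -
    have "(q - 1) * ((E1 * A1 - (q + 1) * (E0 * A1) + q * E1 * A0') * (E1 * (q * (q * z - y))))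
      = q * E1 * A1 * (((q - 1) * E1 - (q + 1) * ((q - 1) * E0)) * (q * z - y) + (q\<^sup>2 * z - y) * ((q - 1) * E0))"
      using A' by algebra
    also have "\<dots> = (q - 1) * (E1 * (q * (q * z\<^sup>2 - y)) * A1)"
      unfolding E by algebra
    finally show ?thesis using \<open>q \<noteq> 1\<close> by (simp only: mult_cancel_left) simp
  qed
  then have "(E1 * A1 - (q + 1) * (E0 * A1) + q * E1 * A0') * (q * (q\<^sup>2 * z\<^sup>2 - y)\<^sup>2 * (q^3 * z\<^sup>2 - y))
    * (E1 * (q * z - y)) = E1 * (A1 * (q * ((q * z\<^sup>2 - y) * (q\<^sup>2 * z\<^sup>2 - y)\<^sup>2 * (q^3 * z\<^sup>2 - y))))"
    by algebra
  also have "\<dots> = (E1 * s\<^sup>2 * (q - 1) * P) * (E1 * (q * z - y))"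
    unfolding A E(2)[symmetric] by (simp add: mult_ac)
  finally show ?thesis using assms by simp
qed

text \<open>The quadratic form in \<open>b1\<close> and \<open>b0'\<close> is (b1 - b0')(b1 - q
  b0'), and both factors have short expressions in \<open>w0\<close> and \<open>w1\<close>; clearing
  denominators then leads to \<open>q_Hahn_identity\<close>.\<close>

lemma diag0_identity:
  fixes q x y s a b c :: complex
  defines "P \<equiv> \<lambda>x. (x - a) * (a * x - y) * ((x - b) * (b * x - y)) * ((x - c) * (c * x - y))"
  defines "v \<equiv> \<lambda>x. k1 y a b c * x - k2 y a b c"
  assumes "q \<noteq> 0" "q \<noteq> 1" "E1 \<noteq> 0" "D1 \<noteq> 0" "D2 \<noteq> 0" "D3 \<noteq> 0"
    and D: "D1 = x\<^sup>2 - y" "D2 = q * x\<^sup>2 - y" "D3 = q\<^sup>2 * x\<^sup>2 - y"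
    and U: "U * (q\<^sup>2 * D2 * D3\<^sup>2) = - E1 * s\<^sup>2 * (q - 1) * P (q * x)"
    and W: "W * (q * D1\<^sup>2 * D2) = E1 * s\<^sup>2 * (q - 1) * P x"
    and w: "w0 * D1 = s * v x" "w1 * D3 = s * v (q * x)"
    and E: "(q - 1) * E0 = x / q - 1" "(q - 1) * E1 = x - 1" "(q - 1) * E2 = q * x - 1"
    and b: "b1 = E2 * w1 - E1 * w0" "b0' = E1 * w1 - E0 * w0"
    and t: "t = - (s\<^sup>2 * (q - 1)\<^sup>2 * (a * b * c)) / q\<^sup>2"
  shows "U + W + E1 * (b1\<^sup>2 - (q + 1) * (b1 * b0') + q * b0'\<^sup>2) = t * E1"
proof -
  \<comment> \<open>This and \<open>b_diff'\<close> rest on \<open>[k+1] - [k] = q^k\<close> and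
    \<open>[k+1] - q [k] = 1\<close>.\<close>
  have b_diff: "q * (b1 - b0') = q * (x * w1) - x * w0"
  proof -
    have "(q - 1) * (q * (b1 - b0')) = q * (((q - 1) * E2 - (q - 1) * E1) * w1) - q * (((q - 1) * E1 - (q - 1) * E0) * w0)"
      unfolding b by algebra
    also have "\<dots> = (q - 1) * (q * (x * w1) - x * w0)"
      unfolding E using \<open>q \<noteq> 0\<close> by (simp add: field_simps)
    finally show ?thesis using \<open>q \<noteq> 1\<close> by (simp only: mult_cancel_left) simp
  qed
  have b_diff': "b1 - q * b0' = w1 - w0"
  proof -
    have "(q - 1) * (b1 - q * b0') = ((q - 1) * E2 - q * ((q - 1) * E1)) * w1 - ((q - 1) * E1 - q * ((q - 1) * E0)) * w0"
      unfolding b by algebra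
    also have "\<dots> = (q - 1) * (w1 - w0)"
      unfolding E using \<open>q \<noteq> 0\<close> by (simp add: field_simps)
    finally show ?thesis using \<open>q \<noteq> 1\<close> by (simp only: mult_cancel_left) simp
  qed
  have t': "q\<^sup>2 * t = - (s\<^sup>2 * (q - 1)\<^sup>2 * (a * b * c))"
    using t \<open>q \<noteq> 0\<close> by simp
  let ?D = "D1\<^sup>2 * D2 * D3\<^sup>2"
  have "(U + W + E1 * (b1\<^sup>2 - (q + 1) * (b1 * b0') + q * b0'\<^sup>2)) * (q\<^sup>2 * ?D)
     = (U * (q\<^sup>2 * D2 * D3\<^sup>2)) * D1\<^sup>2 + (W * (q * D1\<^sup>2 * D2)) * (q * D3\<^sup>2)
       + E1 * q * ((q * (b1 - b0')) * (b1 - q * b0')) * ?D"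
    by algebra
  also have "\<dots> = E1 * s\<^sup>2 * (q * (q - 1) * P x * D3\<^sup>2 - (q - 1) * P (q * x) * D1\<^sup>2)
    + E1 * q * x * D2 * (q * (w1 * D3) * D1 - (w0 * D1) * D3) * ((w1 * D3) * D1 - (w0 * D1) * D3)"
    unfolding U W b_diff b_diff' by algebra
  also have "\<dots> = E1 * s\<^sup>2 * (q * (q - 1) * P x * D3\<^sup>2 - (q - 1) * P (q * x) * D1\<^sup>2
    + q * x * D2 * (q * v (q * x) * D1 - v x * D3) * (v (q * x) * D1 - v x * D3))"
    unfolding w by algebra
  also have "\<dots> = E1 * s\<^sup>2 * - ((q - 1)\<^sup>2 * (a * b * c) * ?D)"
    using q_Hahn_identity[of q x a y b c]
    unfolding P_def v_def D by (simp add: add_eq_0_iff2 mult.assoc)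
  also have "\<dots> = (q\<^sup>2 * t) * E1 * ?D" unfolding t' by simp
  also have "\<dots> = (t * E1) * (q\<^sup>2 * ?D)" by (simp add: mult_ac)
  finally show ?thesis
    using assms(3-8) by (simp only: mult_cancel_right) simp
qed

text \<open>The coefficients enter through equations with cleared denominators, so that
  \<open>Z_den\<close> may vanish at q. Here \<open>w k\<close> stands for
  \<open>\<sigma>\<^sub>k / [k+1]\<close>, and \<open>\<alpha>'\<close> is described without
  \<open>g\<close>.\<close>

lemma q_Hahn_equation_explicit:
  fixes q y d1 d2 d3 s :: complex and \<alpha> \<alpha>' \<beta> \<beta>' w :: "nat \<Rightarrow> complex"
  defines "e \<equiv> \<lambda>n. q_int q (int n)"
  assumes q: "q \<noteq> 0" "\<forall>n\<ge>1. q ^ n \<noteq> 1" and y: "\<And>m. m \<ge> 2 \<Longrightarrow> q ^ m \<noteq> y"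
    and w: "\<And>k. w k * (q ^ (2 * k + 2) - y) = s * (k1 y d1 d2 d3 * q ^ (k + 1) - k2 y d1 d2 d3)"
    and \<alpha>: "\<And>k. k \<ge> 1 \<Longrightarrow> \<alpha> k * Z_den q y (q ^ k) = s\<^sup>2 * Z_num y d1 d2 d3 (q ^ k)"
    \<comment> \<open>for \<open>y = q\<close> the preceding equation is \<open>0 = 0\<close> at \<open>k = 1\<close>\<close>
    and \<alpha>1: "\<alpha> 1 * (q * (q\<^sup>2 - y)\<^sup>2 * (q * q\<^sup>2 - y)) = s\<^sup>2 * ((q - 1) *
      (((q - d1) * (d1 * q - y)) * ((q - d2) * (d2 * q - y)) * ((q - d3) * (d3 * q - y))))"
    and \<beta>: "\<And>k. \<beta> k = e (Suc k) * w k - e k * w (k - 1)"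
    and \<beta>': "\<And>k. \<beta>' k = e (Suc k) * w (Suc k) - e k * w k"
    and \<alpha>': "\<And>k. k \<ge> 1 \<Longrightarrow>
      \<alpha>' k * (e (Suc k) * (q * (q ^ (k + 1) - y))) = e k * (q ^ (k + 2) - y) * \<alpha> (k + 1)"
  shows "q_Hahn_equation q (monic_tridiag \<alpha> \<beta>) (monic_tridiag \<alpha>' \<beta>')
     (- (s\<^sup>2 * (q - 1)\<^sup>2 * (d1 * d2 * d3)) / q\<^sup>2)"
proof -
  have q1: "q \<noteq> 1" using q(2)[rule_format, of 1] by simp
  have e: "(q - 1) * e k = q ^ k - 1" for k
    using q1 by (simp add: e_def q_int_of_nat)
  have e_0: "e 0 = 0" and e_nz: "e (Suc k) \<noteq> 0" for k
    using q1 q(2)[rule_format, of "Suc k"] by (auto simp: e_def q_int_of_nat)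
  have e_rec: "e (Suc (Suc n)) - (q + 1) * e (Suc n) + q * e n = 0" for n
    unfolding e_def by (rule q_int_rec)
  have e_fold: "q_int q (int n) = e n" for n by (simp add: e_def)
  \<comment> \<open>Being a combination of 1 and \<open>q ^ k\<close>, the numerators of
    \<open>w\<close> obey the same recurrence as \<open>[k]\<close>.\<close>
  define N where "N k = s * (k1 y d1 d2 d3 * q ^ (k + 1) - k2 y d1 d2 d3)" for k
  have N_rec: "q * N k - (q + 1) * N (Suc k) + N (Suc (Suc k)) = 0" for k
    by (simp add: N_def algebra_simps)
  define P where "P x = (x - d1) * (d1 * x - y) * ((x - d2) * (d2 * x - y)) * ((x - d3) * (d3 * x - y))" for x
  define t where "t = - (s\<^sup>2 * (q - 1)\<^sup>2 * (d1 * d2 * d3)) / q\<^sup>2"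
  have pow: "q ^ (2 * k) = (q ^ k)\<^sup>2" "q ^ (k * 2) = (q ^ k)\<^sup>2" for k
    by (simp_all add: power_mult[symmetric] mult.commute)
  have \<alpha>_eq: "\<alpha> (Suc k) * (q * ((q * z\<^sup>2 - y) * (q\<^sup>2 * z\<^sup>2 - y)\<^sup>2 * (q ^ 3 * z\<^sup>2 - y)))
      = s\<^sup>2 * ((q * z - 1) * (q * z - y) * P (q * z))" if "z = q ^ k" for k z
  proof -
    have "Z_den q y (q * z) = q * ((q * z\<^sup>2 - y) * (q\<^sup>2 * z\<^sup>2 - y)\<^sup>2 * (q ^ 3 * z\<^sup>2 - y))"
      unfolding Z_den_def by algebra
    moreover have "Z_num y d1 d2 d3 (q * z) = (q * z - 1) * (q * z - y) * P (q * z)"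
      unfolding Z_num_def P_def by (simp only: mult_ac)
    ultimately show ?thesis using \<alpha>[of "Suc k"] that by simp
  qed
  have \<alpha>'_eq: "\<alpha>' (Suc k) * (e (Suc (Suc k)) * (q * (q\<^sup>2 * z - y)))
     = e (Suc k) * (q ^ 3 * z - y) * \<alpha> (Suc (Suc k))" if "z = q ^ k" for k z
    using \<alpha>'[of "Suc k"] that by (simp add: power_numeral_reduce mult.assoc)
  show ?thesis unfolding t_def[symmetric]
  proof (rule q_Hahn_equation_monic_tridiagI[where q = q, unfolded e_fold])
    fix i
    show "e (Suc i) * (\<beta> (Suc i) + \<beta> i) - (q + 1) * (e (Suc i) * \<beta>' i + e i * \<beta> i)
       + q * e i * (\<beta>' i + \<beta>' (i - 1)) = 0"
      by (rule diag1_identity[OF e_rec e_0 \<beta> \<beta>'])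
    define z where "z = q ^ i"
    have E: "(q - 1) * e i = z - 1" "(q - 1) * e (Suc i) = q * z - 1"
       "(q - 1) * e (Suc (Suc i)) = q\<^sup>2 * z - 1" "(q - 1) * e (Suc (Suc (Suc i))) = q ^ 3 * z - 1"
      by (simp_all add: e z_def power_numeral_reduce mult.assoc)
    have nz: "q\<^sup>2 * z \<noteq> y" "q ^ 3 * z \<noteq> y" "q\<^sup>2 * z\<^sup>2 \<noteq> y" "q ^ 3 * z\<^sup>2 \<noteq> y" "q ^ 4 * z\<^sup>2 \<noteq> y"
       "q ^ 5 * z\<^sup>2 \<noteq> y"
      using y[of "i + 2"] y[of "i + 3"] y[of "2 * i + 2"] y[of "2 * i + 3"] y[of "2 * i + 4"]
        y[of "2 * i + 5"]
      by (simp_all add: z_def power_add pow mult_ac power2_eq_square)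
    have w': "w i * (q\<^sup>2 * z\<^sup>2 - y) = N i" "w (Suc i) * (q ^ 4 * z\<^sup>2 - y) = N (Suc i)"
       "w (Suc (Suc i)) * (q ^ 6 * z\<^sup>2 - y) = N (Suc (Suc i))"
      unfolding N_def w[symmetric] by (simp_all add: z_def power_numeral_reduce pow mult_ac power2_eq_square)
    show "e (Suc i) * \<alpha> (Suc (Suc i)) * (\<beta> (Suc (Suc i)) + \<beta> (Suc i))
       - (q + 1) * (e (Suc (Suc i)) * \<beta> (Suc (Suc i)) * \<alpha>' (Suc i) + e (Suc i) * \<alpha> (Suc (Suc i)) * \<beta>' i)
       + q * e (Suc (Suc i)) * \<alpha>' (Suc i) * (\<beta>' (Suc i) + \<beta>' i) = 0"
      by (rule diag_m1_identity[OF q(1) q1 nz(1) \<alpha>'_eq[OF z_def] N_rec w' E])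
        (simp_all add: \<beta> \<beta>')
    show "e (Suc i) * \<alpha> (Suc (Suc (Suc i))) * \<alpha> (Suc (Suc i))
       - (q + 1) * e (Suc (Suc i)) * \<alpha> (Suc (Suc (Suc i))) * \<alpha>' (Suc i)
       + q * e (Suc (Suc (Suc i))) * \<alpha>' (Suc (Suc i)) * \<alpha>' (Suc i) = 0"
    proof (rule diag_m2_identity[of q _ _ "q\<^sup>2 * z" y])
      show "\<alpha>' (Suc (Suc i)) * (e (Suc (Suc (Suc i))) * (q * (q * (q\<^sup>2 * z) - y)))
        = e (Suc (Suc i)) * (q\<^sup>2 * (q\<^sup>2 * z) - y) * \<alpha> (Suc (Suc (Suc i)))"
        using \<alpha>'_eq[of "q * z" "Suc i"] by (simp add: z_def power_numeral_reduce mult.assoc)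
      show "\<alpha>' (Suc i) * (e (Suc (Suc i)) * (q * (q\<^sup>2 * z - y)))
        = e (Suc i) * (q * (q\<^sup>2 * z) - y) * \<alpha> (Suc (Suc i))"
        using \<alpha>'_eq[OF z_def] by (simp add: power_numeral_reduce mult.assoc)
      show "q * (q\<^sup>2 * z) \<noteq> y"
        using nz(2) by (simp add: power_numeral_reduce mult.assoc)
    qed (use nz q(1) e_nz in auto)
    \<comment> \<open>For the entry in row i + 1 and column i the natural variable is
      \<open>q ^ (i + 1)\<close>: the numerators of \<open>w i\<close> and \<open>w (Suc i)\<close>
      then are multiples of \<open>v x\<close> and \<open>v (q * x)\<close> in
      \<open>diag0_identity\<close>.\<close>
    define x where "x = q * z"
    have x: "q\<^sup>2 * z\<^sup>2 = x\<^sup>2" "q ^ 3 * z\<^sup>2 = q * x\<^sup>2" "q ^ 4 * z\<^sup>2 = q\<^sup>2 * x\<^sup>2" "q\<^sup>2 * z = q * x"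
       "q ^ 3 * z = q\<^sup>2 * x" "q ^ 5 * z\<^sup>2 = q ^ 3 * x\<^sup>2" "q * z = x" and x_pow: "x = q ^ Suc i" and z: "z = x / q"
      using q(1) by (simp_all add: x_def z_def power2_eq_square power_numeral_reduce)
    define D1 D2 D3 where D: "D1 = x\<^sup>2 - y" "D2 = q * x\<^sup>2 - y" "D3 = q\<^sup>2 * x\<^sup>2 - y"
    have D_nz: "D1 \<noteq> 0" "D2 \<noteq> 0" "D3 \<noteq> 0" using nz by (simp_all add: D x)
    \<comment> \<open>The off-diagonal coefficients split into \<open>U\<close>, which involves Z at
      \<open>q * x\<close>, and \<open>W\<close>, which involves Z at \<open>x\<close>.\<close>
    define U where "U = e (Suc i) * \<alpha> (Suc (Suc i)) - (q + 1) * (e (Suc (Suc i)) * \<alpha>' (Suc i))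
      + q * e (Suc i) * \<alpha>' (Suc i)"
    define W where "W = e (Suc i) * \<alpha> (Suc i) - (q + 1) * (e i * \<alpha> (Suc i))
      + q * e (Suc i) * (if i = 0 then 0 else \<alpha>' i)"
    have U: "U * (q\<^sup>2 * D2 * D3\<^sup>2) = - e (Suc i) * s\<^sup>2 * (q - 1) * P (q * x)"
      unfolding U_def D
      using nz
      by (intro diag0_upper_part[OF q1 e_nz _ \<alpha>'_eq[OF z_def, unfolded x]
            \<alpha>_eq[OF x_pow] E(2,3)[unfolded x]]) (simp_all add: x)
    have W: "W * (q * D1\<^sup>2 * D2) = e (Suc i) * s\<^sup>2 * (q - 1) * P x"
    proof (cases i)
      \<comment> \<open>Here \<open>q * z\<close> is q and may equal y, which
        \<open>diag0_lower_part\<close> excludes; the cancelled equation for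
        \<open>\<alpha> 1\<close> takes its place.\<close>
      case 0
      have "x = q" using x_pow 0 by simp
      then show ?thesis
        using \<alpha>1 unfolding W_def D P_def 0 by (simp add: e_0 mult_ac)
    next
      case (Suc m)
      then have i: "i \<ge> 1" by simp
      then have nz': "q * z \<noteq> y"
        using y[of "Suc i"] by (simp add: z_def)
      have A':  "\<alpha>' i * (e (Suc i) * (q * (q * z - y))) = e i * (q\<^sup>2 * z - y) * \<alpha> (Suc i)"
        using \<alpha>'[OF i] by (simp add: z_def power2_eq_square)
      have "(e (Suc i) * \<alpha> (Suc i) - (q + 1) * (e i * \<alpha> (Suc i)) + q * e (Suc i) * \<alpha>' i) *
           (q * (q\<^sup>2 * z\<^sup>2 - y)\<^sup>2 * (q ^ 3 * z\<^sup>2 - y)) = e (Suc i) * s\<^sup>2 * (q - 1) * P (q * z)"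
        by (rule diag0_lower_part[OF q1 e_nz nz' A' \<alpha>_eq[OF z_def] E(1,2)])
      then show ?thesis
        using i unfolding W_def D x by simp
    qed
    have N_x: "N i = s * (k1 y d1 d2 d3 * x - k2 y d1 d2 d3)"
      "N (Suc i) = s * (k1 y d1 d2 d3 * (q * x) - k2 y d1 d2 d3)"
      by (simp_all add: N_def x_pow)
    have "U + W + e (Suc i) * ((\<beta> (Suc i))\<^sup>2 - (q + 1) * (\<beta> (Suc i) * \<beta>' i) + q * (\<beta>' i)\<^sup>2) = t * e (Suc i)"
      by (rule diag0_identity[OF q(1) q1 e_nz D_nz D U[unfolded P_def] W[unfolded P_def]
            w'(1)[unfolded x N_x, folded D] w'(2)[unfolded x N_x, folded D]
            E(1)[unfolded z] E(2,3)[unfolded x] _ \<beta>' t_def]) (simp add: \<beta>)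
    then show "e (Suc i) * (\<alpha> (Suc (Suc i)) + (\<beta> (Suc i))\<^sup>2 + \<alpha> (Suc i))
       - (q + 1) * (e (Suc (Suc i)) * \<alpha>' (Suc i) + e (Suc i) * \<beta> (Suc i) * \<beta>' i + e i * \<alpha> (Suc i))
       + q * e (Suc i) * (\<alpha>' (Suc i) + (\<beta>' i)\<^sup>2 + (if i = 0 then 0 else \<alpha>' i)) = t * e (Suc i)"
      unfolding U_def W_def by (simp add: algebra_simps)
  qed
qed

section \<open>Powers of \<open>q\<close> and the values that \<open>y\<close> cannot take\<close>

lemma power_inject_not_root_of_unity:
  fixes q :: complex
  assumes "q \<noteq> 0" "\<forall>n\<ge>1. q ^ n \<noteq> 1"
  shows "q ^ m = q ^ n \<longleftrightarrow> m = n"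
proof
  have "m \<ge> n" if eq: "q ^ m = q ^ n" for m n
  proof (rule ccontr)
    assume "\<not> m \<ge> n"
    then have "q ^ n = q ^ m * q ^ (n - m)" by (simp add: power_add[symmetric])
    then show False using eq assms \<open>\<not> m \<ge> n\<close> by simp
  qed
  then show "q ^ m = q ^ n \<Longrightarrow> m = n" by (metis antisym)
qed simp

text \<open>If y were \<open>q ^ m\<close>, the factor x - y of the numerator would vanish at
  \<open>q ^ m\<close> but the denominator would not. For m = 1 the factor \<open>x^2 - q y\<close>
  of the denominator vanishes too, hence the bound on m.\<close>

lemma q_power_neq_y:
  assumes q: "q \<noteq> 0" "\<forall>n\<ge>1. q ^ n \<noteq> 1"
    and Z: "Z q y d1 d2 d3 (q ^ m) \<noteq> 0" and m: "m \<ge> 2"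
  shows "q ^ m \<noteq> y"
proof
  assume y: "q ^ m = y"
  have "Z_den q y (q ^ m) = (q ^ (2 * m) - q ^ (m + 1)) * (q ^ (2 * m) - q ^ m)\<^sup>2 * (q ^ (2 * m + 1) - q ^ m)"
    by (simp add: Z_den_def y[symmetric] power_mult[symmetric] mult.commute)
  then have "Z_den q y (q ^ m) \<noteq> 0"
    using m by (simp add: power_inject_not_root_of_unity[OF q] del: power_Suc power_Suc2 add_Suc_right)
  then have "Z q y d1 d2 d3 (q ^ m) = 0"
    using y by (simp add: Z_eq Z_num_def)
  with Z show False by simp
qed

text \<open>The claim on \<open>M\<close> is conditional because \<open>\<alpha>'\<close> divides by
  \<open>g k\<close>; membership of \<open>A\<close> in the class is asserted in every case. A
  matrix \<open>A\<close> as assumed exists and is unique by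
  \<open>ex1_monic_matrix\<close>.\<close>

theorem theorem4p1:
  fixes q y d1 d2 d3 \<alpha>1 \<sigma>0 t c0 c1 :: complex
    and \<alpha> \<sigma> \<beta> \<alpha>' \<sigma>' \<beta>' g :: "nat \<Rightarrow> complex"
    and L M A :: inf_matrix
  assumes q: "q \<noteq> 0" "\<forall>n\<ge>1. q ^ n \<noteq> 1"
    and V1: "V q y d1 d2 d3 1 \<noteq> 0"
    and Z: "\<forall>k\<ge>1. Z q y d1 d2 d3 (q ^ k) \<noteq> 0"
    and \<alpha>1: "\<alpha>1 \<noteq> 0"
    and \<sigma>0: "\<sigma>0\<^sup>2 = \<alpha>1 * (V q y d1 d2 d3 1)\<^sup>2 / Z q y d1 d2 d3 q"
  defines "\<alpha> \<equiv> \<lambda>k. \<alpha>1 * Z q y d1 d2 d3 (q ^ k) / Z q y d1 d2 d3 q"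
    and "\<sigma> \<equiv> \<lambda>k. \<sigma>0 * V q y d1 d2 d3 (q ^ k) / V q y d1 d2 d3 1"
  defines "\<beta> \<equiv> \<lambda>k. if k = 0 then \<sigma>0 else \<sigma> k - \<sigma> (k - 1)"
  defines "L \<equiv> monic_tridiag \<alpha> \<beta>"
  assumes A: "A \<in> lower_group" "monic_matrix A" "L \<odot> A = A \<odot> X_mat"
  defines "c0 \<equiv> q_int q 3 * (q * \<sigma>0 - \<sigma> 1) + \<sigma> 2"
    and "c1 \<equiv> q_int q 3 * (\<sigma>0 + \<sigma> 1 - \<sigma> 2)"
  defines "g \<equiv> \<lambda>k. q_int q (int k - 2) * c0 + c1"
  defines "\<sigma>' \<equiv> \<lambda>k. q_int q (int k + 1) / q_int q (int k + 2) * \<sigma> (k + 1)"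
    and "\<alpha>' \<equiv> \<lambda>k. q_int q (int k) * g (k + 1) / (q * q_int q (int k + 1) * g k) * \<alpha> (k + 1)"
  defines "\<beta>' \<equiv> \<lambda>k. if k = 0 then \<sigma>' 0 else \<sigma>' k - \<sigma>' (k - 1)"
  defines "M \<equiv> monic_tridiag \<alpha>' \<beta>'"
    and "t \<equiv> - (\<alpha>1 * (q - 1)\<^sup>2 * d1 * d2 * d3) / (q\<^sup>2 * Z q y d1 d2 d3 q)"
  shows "A \<in> extended_q_Hahn q \<and> recurrence_matrix A L \<and>
         ((\<forall>k\<ge>1. g k \<noteq> 0) \<longrightarrow> M \<in> tridiagonals \<and> q_Hahn_equation q L M t)"
proof -
  define e where "e n = q_int q (int n)" for n
  \<comment> \<open>One scale serves both sequences: \<open>\<sigma> k\<close> is \<open>s\<close>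
    times V, and \<open>\<alpha> k\<close> is the square of \<open>s\<close> times Z, at
    \<open>q ^ k\<close>. The factor (q x - 1)/(q - 1) of V is \<open>[k+1]\<close>, and
    \<open>w\<close> is the rest.\<close>
  define s where "s = \<sigma>0 / V q y d1 d2 d3 1"
  define w where "w k = s * (k1 y d1 d2 d3 * q ^ (k + 1) - k2 y d1 d2 d3) / (q ^ (2 * k + 2) - y)" for k
  have q1: "q \<noteq> 1" using q(2)[rule_format, of 1] by simp
  have e: "e k = (q ^ k - 1) / (q - 1)" for k
    by (simp add: e_def q_int_of_nat)
  have e_0: "e 0 = 0" and e_1: "e (Suc 0) = 1" and e_nz: "e (Suc k) \<noteq> 0" for k
    using q1 q(2)[rule_format, of "Suc k"] by (auto simp: e)
  have e_int: "q_int q (int k) = e k" "q_int q (int k + 1) = e (Suc k)"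
    "q_int q (int k + 2) = e (Suc (Suc k))" "q_int q 3 = e 3" for k
    by (simp_all add: e_def add.commute)
  have Zq: "Z q y d1 d2 d3 q \<noteq> 0" using Z[rule_format, of 1] by simp
  have s2: "s\<^sup>2 = \<alpha>1 / Z q y d1 d2 d3 q"
    using \<sigma>0 V1 by (simp add: s_def power_divide)
  have y: "q ^ m \<noteq> y" if "m \<ge> 2" for m
    using q_power_neq_y[OF q Z[rule_format, of m] that] that by simp
  have pow: "q ^ (2 * k) = (q ^ k)\<^sup>2" for k
    by (simp add: power_mult[symmetric] mult.commute)
  have w: "w k * (q ^ (2 * k + 2) - y) = s * (k1 y d1 d2 d3 * q ^ (k + 1) - k2 y d1 d2 d3)" for k
    using y[of "2 * k + 2"] by (simp add: w_def)
  have \<sigma>: "\<sigma> k = e (Suc k) * w k" for k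
  proof -
    have V_den: "V_den q y (q ^ k) = (q - 1) * (q ^ (2 * k + 2) - y)"
      by (simp add: V_den_def power_add pow power2_eq_square)
    then have "V q y d1 d2 d3 (q ^ k) = V_num q y d1 d2 d3 (q ^ k) / V_den q y (q ^ k)"
      using y[of "2 * k + 2"] q1 by (intro V_eq) simp
    then show ?thesis
      unfolding V_den \<sigma>_def V_num_def w_def s_def e by (simp add: mult_ac)
  qed
  have \<sigma>0_eq: "\<sigma>0 = w 0"
    using \<sigma>[of 0] V1 by (simp add: \<sigma>_def e_1)
  have \<beta>: "\<beta> k = e (Suc k) * w k - e k * w (k - 1)" for k
    by (cases k) (simp_all add: \<beta>_def \<sigma> \<sigma>0_eq e_0 e_1)
  have \<sigma>': "\<sigma>' k = e (Suc k) * w (Suc k)" for k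
    using e_nz by (simp add: \<sigma>'_def \<sigma> e_int)
  have \<beta>': "\<beta>' k = e (Suc k) * w (Suc k) - e k * w k" for k
    by (cases k) (simp_all add: \<beta>'_def \<sigma>' e_0)
  have \<alpha>_nz: "\<alpha> k \<noteq> 0" if "k \<ge> 1" for k
    using Z that \<alpha>1 Zq by (simp add: \<alpha>_def)
  have \<alpha>_s: "\<alpha> k = s\<^sup>2 * Z q y d1 d2 d3 (q ^ k)" for k
    by (simp add: \<alpha>_def s2)
  have \<alpha>_eq: "\<alpha> k * Z_den q y (q ^ k) = s\<^sup>2 * Z_num y d1 d2 d3 (q ^ k)" if k: "k \<ge> 1" for k
  proof (cases "k = 1 \<and> y = q")
    case True
    then show ?thesis by (simp add: Z_num_def Z_den_def power2_eq_square)
  next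
    case False
    \<comment> \<open>The factor \<open>x^2 - q y\<close> at \<open>q ^ k\<close> is
      \<open>q (q^(2k-1) - y)\<close>, and the exponent is below 2 only for k = 1.\<close>
    have "q ^ (2 * k - 1) \<noteq> y" using False y[of "2 * k - 1"] k by (cases "k = 1") auto
    moreover have "(q ^ k)\<^sup>2 = q * q ^ (2 * k - 1)"
      using k by (simp add: pow[symmetric] power_Suc[symmetric] del: power_Suc)
    ultimately have "Z_den q y (q ^ k) \<noteq> 0"
      using q y[of "2 * k"] y[of "2 * k + 1"] k
      unfolding Z_den_def by (simp add: pow)
    then show ?thesis by (simp add: \<alpha>_s Z_eq)
  qed
  have "(q\<^sup>2 - y)\<^sup>2 * (q * q\<^sup>2 - y) \<noteq> 0"
    using y[of 2] y[of 3] by (simp add: power_numeral_reduce)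
  then have \<alpha>_1: "\<alpha> 1 * (q * (q\<^sup>2 - y)\<^sup>2 * (q * q\<^sup>2 - y)) = s\<^sup>2 * ((q - 1) *
      (((q - d1) * (d1 * q - y)) * ((q - d2) * (d2 * q - y)) * ((q - d3) * (d3 * q - y))))"
    using q(1) by (simp add: \<alpha>_s Z_at_q)
  \<comment> \<open>The matrix \<open>M'\<close> built from these coefficients solves the equation
    whether or not \<open>g\<close> vanishes, so it witnesses membership; \<open>g\<close> matters
    only for \<open>M = M'\<close>.\<close>
  define \<alpha>'' where "\<alpha>'' k = e k * (q ^ (k + 2) - y) * \<alpha> (k + 1) / (e (Suc k) * (q * (q ^ (k + 1) - y)))" for k
  have \<alpha>'': "\<alpha>'' k * (e (Suc k) * (q * (q ^ (k + 1) - y))) = e k * (q ^ (k + 2) - y) * \<alpha> (k + 1)"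
    if "k \<ge> 1" for k
    using that e_nz q(1) y[of "k + 1"] by (simp add: \<alpha>''_def)
  have t: "t = - (s\<^sup>2 * (q - 1)\<^sup>2 * (d1 * d2 * d3)) / q\<^sup>2"
    by (simp add: t_def s2 mult_ac)
  define M' where "M' = monic_tridiag \<alpha>'' \<beta>'"
  have eqn: "q_Hahn_equation q L M' t"
    unfolding L_def M'_def t
    by (rule q_Hahn_equation_explicit[OF q y w \<alpha>_eq \<alpha>_1, folded e_def]) (use \<beta> \<beta>' \<alpha>'' in simp_all)
  have \<alpha>''_nz: "\<alpha>'' (Suc k) \<noteq> 0" for k
    using e_nz \<alpha>_nz q(1) y[of "Suc (Suc k)"] y[of "Suc (Suc (Suc k))"] by (simp add: \<alpha>''_def)
  have M': "M' \<in> tridiagonals"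
    using \<alpha>''_nz by (auto simp: M'_def tridiagonals_def monic_tridiag_def)
  have "L \<in> tridiagonals"
    using \<alpha>_nz by (auto simp: L_def tridiagonals_def monic_tridiag_def)
  then have rec: "recurrence_matrix A L"
    using A(3) by (simp add: recurrence_matrix_def)
  have "A \<in> MOP"
    using MOP_if_recurrence[OF A(1,2) A(3)[unfolded L_def] \<alpha>_nz] .
  then have "A \<in> extended_q_Hahn q"
    unfolding extended_q_Hahn_def using rec M' eqn by blast
  moreover have "M = M'" if g_nz: "\<forall>k\<ge>1. g k \<noteq> 0"
  proof -
    have e_23: "e 2 = 1 + q" "e 3 = 1 + q + q\<^sup>2"
      using q1 by (simp_all add: e field_simps power_numeral_reduce)
    have w_rec: "q * (w 0 * (q\<^sup>2 - y)) - (q + 1) * (w 1 * (q ^ 4 - y)) + w 2 * (q ^ 6 - y) = 0"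
    proof -
      have "w 0 * (q\<^sup>2 - y) = s * (k1 y d1 d2 d3 * q - k2 y d1 d2 d3)"
        "w 1 * (q ^ 4 - y) = s * (k1 y d1 d2 d3 * q\<^sup>2 - k2 y d1 d2 d3)"
        "w 2 * (q ^ 6 - y) = s * (k1 y d1 d2 d3 * q ^ 3 - k2 y d1 d2 d3)"
        using w[of 0] w[of 1] w[of 2] by (simp_all add: numeral_2_eq_2[symmetric])
      then show ?thesis by algebra
    qed
    have c: "c0 = (1 + q + q\<^sup>2) * (q * w 0 - (1 + q) * w 1 + w 2)"
      "c1 = (1 + q + q\<^sup>2) * (w 0 + (1 + q) * w 1 - (1 + q + q\<^sup>2) * w 2)"
      by (simp_all add: c0_def c1_def \<sigma> \<sigma>0_eq e_int e_23 numeral_2_eq_2[symmetric] numeral_3_eq_3[symmetric] algebra_simps)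
    \<comment> \<open>This proportionality of \<open>c0\<close> and \<open>c1\<close> is equivalent
      to \<open>g k\<close> being a multiple of \<open>q ^ (k + 1) - y\<close>. If \<open>c0\<close>
      were 0, \<open>g\<close> would vanish identically.\<close>
    have c01: "c1 * (q ^ 3 * (q - 1)) = c0 * (q ^ 3 - y)"
      using w_rec unfolding c by algebra
    have g: "g k * (q ^ 3 * (q - 1)) = c0 * (q ^ (k + 1) - y)" for k
    proof -
      have "q_int q (int k - 2) = (q ^ k / q\<^sup>2 - 1) / (q - 1)"
        using q(1) by (simp add: q_int_def power_int_diff)
      then have "q_int q (int k - 2) * (q\<^sup>2 * (q - 1)) = q ^ k - q\<^sup>2"
        using q(1) q1 by (simp add: field_simps)
      moreover have "(u * c0 + c1) * (q ^ 3 * (q - 1)) = c0 * (q * x - y)"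
        if "u * (q\<^sup>2 * (q - 1)) = x - q\<^sup>2" for u x
        using that c01 by algebra
      ultimately show ?thesis
        by (simp add: g_def)
    qed
    have "c0 \<noteq> 0" using g[of 1] g_nz q(1) q1 by auto
    have "\<alpha>' k = \<alpha>'' k" if k: "k \<ge> 1" for k
    proof -
      have "g k = c0 * (q ^ (k + 1) - y) / (q ^ 3 * (q - 1))" for k
        using g[of k] q(1) q1 by (simp add: eq_divide_eq)
      then have "g (k + 1) / g k = (q ^ (k + 2) - y) / (q ^ (k + 1) - y)"
        using \<open>c0 \<noteq> 0\<close> q(1) q1 by simp
      moreover have "\<alpha>' k = e k * (g (k + 1) / g k) * \<alpha> (k + 1) / (e (Suc k) * q)"
        by (simp add: \<alpha>'_def e_int mult_ac)
      ultimately show ?thesis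
        by (simp add: \<alpha>''_def mult_ac)
    qed
    then show ?thesis
      \<comment> \<open>Agreement for k >= 1 suffices, since the value at 0 is not an entry of the
        matrix.\<close>
      by (auto simp: M_def M'_def monic_tridiag_def fun_eq_iff)
  qed
  ultimately show ?thesis using rec M' eqn by auto
qed

end
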